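(* Let $r$ be a positive even integer and put $N=r^2-1=(r-1)(r+1)$. Define numbers $a_1,\dots,a_{4N}$ as follows: \[ a_{N}=(-1)^{(r+2)/2}\,2r\,\beta^{N},\qquad a_{3N}=(-1)^{r/2}\,2r\,\beta^{3N}; \] for every index $i\notin\{N,3N\}$ of one of the following forms, \[ a_{(r-1)(4j-3)}=-(r-1)\beta^{(r-1)(4j-3)},\quad a_{(r-1)(4j-1)}=(r-1)\beta^{(r-1)(4j-1)}\quad (j=1,\dots,r+1), \] \[ a_{(r+1)(4j-3)}=(r+1)\beta^{(r+1)(4j-3)},\quad a_{(r+1)(4j-1)}=-(r+1)\beta^{(r+1)(4j-1)}\quad (j=1,\dots,r-1); \] and $a_i=0$ for all other $i\in\{1,\dots,4N\}$. Then \[ \arctan\frac{1}{L_r}=P\bigl(1,\alpha^{4N},4N,(a_1,a_2,\dots,a_{4N})\bigr)=\sum_{k=0}^\infty\frac{1}{\alpha^{4Nk}}\sum_{i=1}^{4N}\frac{a_i}{4Nk+i}. \]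
   Context: $\alpha=(1+\sqrt5)/2$ is the golden ratio and $\beta=-1/\alpha=(1-\sqrt5)/2$. The Lucas numbers are $L_n=\alpha^n+\beta^n$. For integers $s,n\ge1$, a number $b$ with $|b|>1$ and a vector $A=(a_1,\dots,a_n)$, the notation $P(s,b,n,A)$ denotes $\sum_{k=0}^\infty b^{-k}\sum_{j=1}^n a_j/(kn+j)^s$. *)

theory Defs
  imports "HOL-Analysis.Analysis"
begin

definition golden :: real where
  "golden = (1 + sqrt 5) / 2"

definition golden_conj :: real where
  "golden_conj = (1 - sqrt 5) / 2"

definition Lucas :: "nat \<Rightarrow> real" where
  "Lucas n = golden ^ n + golden_conj ^ n"

text \<open>
  The vector \<open>A = (a\<^sub>1, \<dots>, a\<^sub>n)\<close> is a function on the naturals of which only the values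
  at \<open>1, \<dots>, n\<close> matter.  The notation is meant for \<open>s \<ge> 1\<close>, \<open>n \<ge> 1\<close> and \<open>\<bar>b\<bar> > 1\<close>.
\<close>

definition bbp :: "nat \<Rightarrow> real \<Rightarrow> nat \<Rightarrow> (nat \<Rightarrow> real) \<Rightarrow> real" where
  "bbp s b n A = (\<Sum>k. (1 / b ^ k) * (\<Sum>j=1..n. A j / real (k * n + j) ^ s))"

text \<open>
  For even \<open>r > 0\<close> the four families of indices below are pairwise disjoint away from \<open>N\<close> and
  \<open>3 N\<close>: within a family pair the residues modulo 4 differ, and a common odd multiple of the
  coprime numbers \<open>r - 1\<close> and \<open>r + 1\<close> in the range \<open>1, \<dots>, 4 N\<close> is \<open>N\<close> or \<open>3 N\<close>.
  So the order of the last four cases is immaterial.  Truncated subtraction is harmless,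
  as \<open>r \<ge> 2\<close> and \<open>j \<ge> 1\<close>.
\<close>

definition arctan_coeff :: "nat \<Rightarrow> nat \<Rightarrow> real" where
  "arctan_coeff r i =
    (let N = r\<^sup>2 - 1 in
     if i = N then (-1) ^ ((r + 2) div 2) * (2 * real r) * golden_conj ^ N
     else if i = 3 * N then (-1) ^ (r div 2) * (2 * real r) * golden_conj ^ (3 * N)
     else if \<exists>j\<in>{1..r + 1}. i = (r - 1) * (4 * j - 3) then - real (r - 1) * golden_conj ^ i
     else if \<exists>j\<in>{1..r + 1}. i = (r - 1) * (4 * j - 1) then real (r - 1) * golden_conj ^ i
     else if \<exists>j\<in>{1..r - 1}. i = (r + 1) * (4 * j - 3) then real (r + 1) * golden_conj ^ i
     else if \<exists>j\<in>{1..r - 1}. i = (r + 1) * (4 * j - 1) then - real (r + 1) * golden_conj ^ i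
     else 0)"

end

theory Submission
  imports Defs
begin

text \<open>
  Since \<open>\<beta>\<^sup>2 - 1 = \<beta>\<close> and \<open>r\<close> is even, the addition theorem gives
  \<open>arctan (1 / L\<^sub>r) = arctan (\<beta>\<^bsup>r+1\<^esup>) - arctan (\<beta>\<^bsup>r-1\<^esup>)\<close>.  Spreading the Taylor series of
  \<open>arctan (\<beta>\<^bsup>p\<^esup>)\<close> over the multiples of \<open>p\<close> turns it into
  \<open>\<Sum>\<^sub>n c\<^sub>n \<beta>\<^bsup>n\<^esup> / n\<close>, where \<open>c\<^sub>n = p \<chi>(n / p)\<close> for \<open>p | n\<close> and \<open>\<chi>\<close> is the nontrivial character
  modulo 4.  For \<open>p = r - 1\<close> and \<open>p = r + 1\<close> the coefficients \<open>c\<^sub>n\<close> have the common period \<open>4 N\<close>,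
  and \<open>\<beta>\<^bsup>4N\<^esup> = \<alpha>\<^bsup>-4N\<^esup>\<close>, so summing in blocks of length \<open>4 N\<close> yields the formula.
\<close>

definition chi4 :: "nat \<Rightarrow> real" where
  "chi4 n = (if n mod 4 = 1 then 1 else if n mod 4 = 3 then - 1 else 0)"

text \<open>The weight \<open>p\<close> stays outside, so that the values are only 0, 1 and
  -1.\<close>

definition dilated_chi4 :: "nat \<Rightarrow> nat \<Rightarrow> real" where
  "dilated_chi4 p n = (if p dvd n then chi4 (n div p) else 0)"

lemma chi4_odd: "chi4 (2 * m + 1) = (- 1) ^ m"
proof (cases "even m")
  case True
  then obtain k where "m = 2 * k" by blast
  then have "(2 * m + 1) mod 4 = 1" by presburger
  with True show ?thesis by (simp add: chi4_def)
next
  case False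
  then obtain k where "m = 2 * k + 1" by (blast elim: oddE)
  then have "(2 * m + 1) mod 4 = 3" by presburger
  with False show ?thesis by (simp add: chi4_def)
qed

lemma chi4_even: "even n \<Longrightarrow> chi4 n = 0"
proof -
  assume "even n"
  then have "n mod 4 \<noteq> 1" "n mod 4 \<noteq> 3" by presburger+
  then show ?thesis by (simp add: chi4_def)
qed

lemma chi4_mult_3: "chi4 (3 * n) = - chi4 n"
proof -
  have "n mod 4 = 0 \<or> n mod 4 = 1 \<or> n mod 4 = 2 \<or> n mod 4 = 3" by presburger
  moreover have "(3 * n) mod 4 = (3 * (n mod 4)) mod 4" by (simp add: mod_mult_right_eq)
  ultimately show ?thesis by (auto simp: chi4_def)
qed

text \<open>With M = p t the shift moves the quotient by \<open>p\<close> by 4 t k, which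
  \<open>chi4\<close> ignores. Allowing any multiple \<open>M\<close> of \<open>p\<close> lets the
  same \<open>N\<close> serve for both r - 1 and r + 1.\<close>

lemma dilated_chi4_add_period:
  assumes "p > 0" "p dvd M"
  shows "dilated_chi4 p (4 * M * k + n) = dilated_chi4 p n"
proof -
  obtain t where t: "M = p * t" using assms by blast
  have "p dvd 4 * M * k + n \<longleftrightarrow> p dvd n"
    unfolding t by (simp add: dvd_add_right_iff)
  moreover have "(4 * M * k + n) div p = 4 * (t * k) + n div p"
    using div_mult_self2[of p n "4 * (t * k)"] assms by (simp add: t algebra_simps)
  ultimately show ?thesis by (simp add: dilated_chi4_def chi4_def)
qed

text \<open>This is the Gregory series with zero terms put in at the even indices, so that the terms
  are indexed by the denominator itself.\<close>

lemma chi4_series_arctan: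
  assumes "\<bar>y\<bar> \<le> 1"
  shows "(\<lambda>n. chi4 n * y ^ n / real n) sums arctan y"
proof -
  let ?f = "\<lambda>n. chi4 n * y ^ n / real n"
  have "(\<lambda>k. (- 1) ^ k * (1 / real (k * 2 + 1) * y ^ (k * 2 + 1))) sums arctan y"
    using summable_arctan_series[OF assms] arctan_series[OF assms] by (simp add: sums_iff)
  moreover have "(\<lambda>k. (- 1) ^ k * (1 / real (k * 2 + 1) * y ^ (k * 2 + 1))) = (\<lambda>k. ?f (2 * k + 1))"
    by (rule ext) (simp only: chi4_odd, simp add: mult.commute)
  ultimately have "(\<lambda>k. ?f (2 * k + 1)) sums arctan y" by simp
  moreover have "strict_mono (\<lambda>k::nat. 2 * k + 1)" by (simp add: strict_mono_def)
  moreover have "?f n = 0" if "n \<notin> range (\<lambda>k. 2 * k + 1)" for n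
    using that by (cases "even n") (auto simp: chi4_even elim!: oddE)
  ultimately show ?thesis
    using sums_mono_reindex[of "\<lambda>k. 2 * k + 1" ?f "arctan y"] by blast
qed

text \<open>Term m of the series for arctan (y^p) moves to index n = p m. The weight
  \<open>p\<close> compensates for the larger denominator: 1/m = p/(p m).\<close>

lemma dilated_chi4_series_arctan:
  assumes "p > 0" "\<bar>y\<bar> \<le> 1"
  shows "(\<lambda>n. real p * dilated_chi4 p n * y ^ n / real n) sums arctan (y ^ p)"
proof -
  let ?g = "\<lambda>n. real p * dilated_chi4 p n * y ^ n / real n"
  have "(\<lambda>n. chi4 n * (y ^ p) ^ n / real n) sums arctan (y ^ p)"
    using assms by (intro chi4_series_arctan) (simp add: power_abs power_le_one)
  moreover have "(\<lambda>n. chi4 n * (y ^ p) ^ n / real n) = (\<lambda>n. ?g (p * n))"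
    using assms by (simp add: dilated_chi4_def power_mult)
  ultimately have "(\<lambda>n. ?g (p * n)) sums arctan (y ^ p)" by simp
  moreover have "strict_mono (\<lambda>n. p * n)" using assms by (simp add: strict_mono_def)
  moreover have "?g n = 0" if "n \<notin> range (\<lambda>n. p * n)" for n
    using that by (auto simp: dilated_chi4_def dvd_def)
  ultimately show ?thesis
    using sums_mono_reindex[of "\<lambda>n. p * n" ?g "arctan (y ^ p)"] by blast
qed

lemma golden_mult_conj: "golden * golden_conj = - 1"
  by (simp add: golden_def golden_conj_def field_simps)

lemma golden_conj_square: "golden_conj\<^sup>2 = golden_conj + 1"
  by (simp add: golden_conj_def power2_eq_square field_simps)

lemma abs_golden_conj: "\<bar>golden_conj\<bar> < 1"
proof -
  have "sqrt 5 < 3" "1 < sqrt 5" by (simp_all add: real_less_lsqrt real_less_rsqrt)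
  then show ?thesis by (simp add: golden_conj_def)
qed

lemma golden_conj_power_even:
  assumes "even n"
  shows "golden_conj ^ n = 1 / golden ^ n"
proof -
  have "golden_conj ^ n * golden ^ n = 1"
    using assms by (metis golden_mult_conj mult.commute power_mult_distrib power_minus_even power_one)
  then show ?thesis by (metis eq_divide_eq mult_zero_right zero_neq_one)
qed

text \<open>The two powers differ by \<beta>^r and have product \<beta>^(2r), so the addition
  theorem yields \<beta>^r / (1 + \<beta>^(2r)) = 1 / (\<beta>^(-r) + \<beta>^r), and \<beta>^(-r) =
  \<alpha>^r for even r.\<close>

lemma arctan_inverse_Lucas:
  assumes "r > 0" "even r"
  shows "arctan (1 / Lucas r) = arctan (golden_conj ^ (r + 1)) - arctan (golden_conj ^ (r - 1))"
proof -
  let ?b = golden_conj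
  obtain p where p: "r = Suc p" using assms by (cases r) auto
  \<comment> \<open>Evenness rules out r = 1. Hence both powers are less than 1 in absolute value,
    as the addition theorem requires.\<close>
  have "p > 0" using assms p by (cases p) auto
  have lt1: "\<bar>?b ^ m\<bar> < 1" if "m > 0" for m
    using abs_golden_conj that by (simp add: power_abs power_less_one_iff)
  have pr: "?b ^ r = 1 / golden ^ r" by (rule golden_conj_power_even[OF assms(2)])
  have nz: "?b ^ r \<noteq> 0" using golden_mult_conj by auto
  have sub: "?b ^ (r + 1) - ?b ^ p = ?b ^ r"
  proof -
    have "?b ^ (r + 1) - ?b ^ p = ?b ^ p * (?b\<^sup>2 - 1)"
      by (simp add: p power2_eq_square algebra_simps)
    then show ?thesis by (simp add: golden_conj_square p)
  qed
  have prod: "?b ^ (r + 1) * ?b ^ p = ?b ^ r * ?b ^ r"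
    by (simp add: p)
  have "arctan (?b ^ (r + 1)) - arctan (?b ^ (r - 1)) = arctan (?b ^ (r + 1)) + arctan (- (?b ^ p))"
    by (simp add: p arctan_minus)
  also have "\<dots> = arctan ((?b ^ (r + 1) + - (?b ^ p)) / (1 - ?b ^ (r + 1) * (- (?b ^ p))))"
    using lt1[of "r + 1"] lt1[OF \<open>p > 0\<close>] by (intro arctan_add) auto
  also have "(?b ^ (r + 1) + - (?b ^ p)) / (1 - ?b ^ (r + 1) * (- (?b ^ p))) = ?b ^ r / (1 + ?b ^ r * ?b ^ r)"
    using sub prod by simp
  also have "\<dots> = 1 / Lucas r"
  proof -
    have g: "golden ^ r = 1 / ?b ^ r" using pr by simp
    show ?thesis using nz by (simp add: Lucas_def g field_simps)
  qed
  finally show ?thesis by simp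
qed

text \<open>Translates the index families of \<open>arctan_coeff\<close> into residues of the
  quotient: c = 3 gives residue 1 and c = 1 gives residue 3. The bound on \<open>i\<close> matches
  the range j \<le> q.\<close>

lemma odd_multiple_mod4:
  fixes p q i c :: nat
  assumes "p > 0" "i \<le> 4 * (p * q)" "c = 1 \<or> c = 3"
  shows "(\<exists>j\<in>{1..q}. i = p * (4 * j - c)) \<longleftrightarrow> p dvd i \<and> i div p mod 4 = 4 - c"
proof
  assume "\<exists>j\<in>{1..q}. i = p * (4 * j - c)"
  then obtain j where j: "j \<in> {1..q}" "i = p * (4 * j - c)" by blast
  then obtain j' where "j = Suc j'" by (cases j) auto
  then have "4 * j - c = 4 * j' + (4 - c)" "4 - c < 4" using assms(3) by auto
  then have "(4 * j - c) mod 4 = 4 - c" by simp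
  with j assms(1) show "p dvd i \<and> i div p mod 4 = 4 - c" by simp
next
  assume R: "p dvd i \<and> i div p mod 4 = 4 - c"
  then obtain t where t: "i = p * t" by blast
  have tm: "t mod 4 = 4 - c" using R t assms(1) by simp
  obtain u where u: "t = 4 * u + (4 - c)" using mult_div_mod_eq[of 4 t] tm by metis
  have "t \<le> 4 * q" using assms(1,2) t by simp
  with u assms(3) have "u + 1 \<le> q" by auto
  moreover have "t = 4 * (u + 1) - c" using u assms(3) by auto
  ultimately show "\<exists>j\<in>{1..q}. i = p * (4 * j - c)" using t by (intro bexI[of _ "u + 1"]) auto
qed

text \<open>The four families are the supports of the two dilated characters, split by sign. These
  overlap only at \<open>N\<close> and \<open>3 * N\<close>, where the weights r + 1 and r - 1 add
  up to 2r in absolute value.\<close>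

lemma arctan_coeff_eq:
  assumes r: "r > 0" "even r" and i: "i \<in> {1..4 * (r\<^sup>2 - 1)}"
  shows "arctan_coeff r i =
    (real (r + 1) * dilated_chi4 (r + 1) i - real (r - 1) * dilated_chi4 (r - 1) i) * golden_conj ^ i"
proof -
  define p q where "p = r - 1" and "q = r + 1"
  obtain s where s: "r = 2 * s" "s > 0" using r by auto
  have pq: "p > 0" "q > 0" "odd p" "odd q" using s by (auto simp: p_def q_def)
  have N: "r\<^sup>2 - 1 = p * q"
    using s by (simp add: p_def q_def power2_eq_square algebra_simps)
  have "coprime p q"
  proof -
    have "gcd p (p + 2) = gcd p 2" by (rule gcd_add2)
    moreover have "q = p + 2" using s by (simp add: p_def q_def)
    moreover have "coprime p 2" using pq by simp
    ultimately show ?thesis by (simp only: coprime_iff_gcd_eq_1)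
  qed
  have chi_q: "chi4 q = (- 1) ^ s" using chi4_odd[of s] by (simp add: q_def s)
  \<comment> \<open>The odd numbers \<open>p\<close> and \<open>q\<close> differ by 2, so their
    characters are opposite; the subtraction in the coefficient therefore adds the weights.\<close>
  have chi_p: "chi4 p = - ((- 1) ^ s)"
    using chi4_odd[of "s - 1"] s by (cases s) (simp_all add: p_def)
  have le: "i \<le> 4 * (p * q)" "i \<le> 4 * (q * p)" using i N by (auto simp: mult.commute)
  have F: "(\<exists>j\<in>{1..r + 1}. i = (r - 1) * (4 * j - 3)) \<longleftrightarrow> p dvd i \<and> i div p mod 4 = 1"
    "(\<exists>j\<in>{1..r + 1}. i = (r - 1) * (4 * j - 1)) \<longleftrightarrow> p dvd i \<and> i div p mod 4 = 3"
    "(\<exists>j\<in>{1..r - 1}. i = (r + 1) * (4 * j - 3)) \<longleftrightarrow> q dvd i \<and> i div q mod 4 = 1"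
    "(\<exists>j\<in>{1..r - 1}. i = (r + 1) * (4 * j - 1)) \<longleftrightarrow> q dvd i \<and> i div q mod 4 = 3"
    using odd_multiple_mod4[OF pq(1) le(1), of 3] odd_multiple_mod4[OF pq(1) le(1), of 1]
      odd_multiple_mod4[OF pq(2) le(2), of 3] odd_multiple_mod4[OF pq(2) le(2), of 1]
    unfolding p_def q_def by simp_all
  have coeff: "arctan_coeff r i =
     (if i = p * q then (- 1) ^ (s + 1) * (2 * real r) * golden_conj ^ i
      else if i = 3 * (p * q) then (- 1) ^ s * (2 * real r) * golden_conj ^ i
      else if p dvd i \<and> i div p mod 4 = 1 then - real p * golden_conj ^ i
      else if p dvd i \<and> i div p mod 4 = 3 then real p * golden_conj ^ i
      else if q dvd i \<and> i div q mod 4 = 1 then real q * golden_conj ^ i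
      else if q dvd i \<and> i div q mod 4 = 3 then - real q * golden_conj ^ i
      else 0)"
    unfolding arctan_coeff_def Let_def N F using s by (simp add: p_def q_def)
  have sum: "real p + real q = 2 * real r" using s by (simp add: p_def q_def of_nat_diff)
  consider "i = p * q" | "i = 3 * (p * q)" | "i \<noteq> p * q" "i \<noteq> 3 * (p * q)" by blast
  then have "arctan_coeff r i = (real q * dilated_chi4 q i - real p * dilated_chi4 p i) * golden_conj ^ i"
  proof cases
    case 1
    then have "real q * dilated_chi4 q i - real p * dilated_chi4 p i = - (real p + real q) * (- 1) ^ s"
      using pq by (simp add: dilated_chi4_def chi_p chi_q algebra_simps)
    with 1 show ?thesis unfolding coeff sum by simp
  next
    case 2
    have "i div p = 3 * q" "i div q = 3 * p" "p dvd i" "q dvd i" using 2 pq by auto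
    then have "real q * dilated_chi4 q i - real p * dilated_chi4 p i = (real p + real q) * (- 1) ^ s"
      by (simp add: dilated_chi4_def chi4_mult_3 chi_p chi_q distrib_right)
    with 2 pq show ?thesis unfolding coeff sum by simp
  next
    case 3
    \<comment> \<open>A common multiple of the coprime \<open>p\<close> and \<open>q\<close> in the
      range is p q t with 1 \<le> t \<le> 4. As t = 1 and t = 3 are excluded, t is even, and
      \<open>chi4\<close> vanishes at the even quotient.\<close>
    have "dilated_chi4 p i = 0 \<or> dilated_chi4 q i = 0"
    proof (cases "p dvd i \<and> q dvd i")
      case True
      then have "p * q dvd i" using \<open>coprime p q\<close> by (simp add: divides_mult)
      then obtain t where t: "i = p * q * t" by blast
      have "t \<le> 4" "t > 0" using t le(1) i pq by (auto intro: Nat.gr0I)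
      moreover have "t \<noteq> 1" "t \<noteq> 3" using t 3 by auto
      ultimately have "t = 2 \<or> t = 4" by linarith
      moreover have "i div p = q * t" using t pq by (simp add: mult.assoc)
      ultimately have "even (i div p)" by auto
      then show ?thesis by (simp add: dilated_chi4_def chi4_even)
    qed (auto simp: dilated_chi4_def)
    with 3 show ?thesis
      by (auto simp: coeff dilated_chi4_def chi4_def split: if_splits)
  qed
  then show ?thesis by (simp add: p_def q_def)
qed

text \<open>Grouping a series naturally gives blocks that start at multiples of \<open>M\<close>.
  Dropping the zero term first shifts them to the index range 1 to \<open>M\<close> used in
  \<open>bbp\<close>.\<close>

lemma sums_blocks_from_1:
  fixes f :: "nat \<Rightarrow> real"
  assumes "f sums s" "f 0 = 0" "M > 0"
  shows "(\<lambda>k. \<Sum>i=1..M. f (M * k + i)) sums s"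
proof -
  have "(\<lambda>n. f (Suc n)) sums s" using assms sums_Suc_iff[of f s] by simp
  then have "(\<lambda>k. \<Sum>n = k * M..<k * M + M. f (Suc n)) sums s"
    using assms(3) by (rule sums_group)
  moreover have "(\<Sum>n = k * M..<k * M + M. f (Suc n)) = (\<Sum>i=1..M. f (M * k + i))" for k
    by (rule sum.reindex_bij_witness[of _ "\<lambda>i. k * M + i - 1" "\<lambda>n. Suc n - k * M"])
       (auto simp: mult.commute)
  ultimately show ?thesis by simp
qed

theorem theorem3p6:
  fixes r N :: nat
  assumes "r > 0" and "even r" and "N = r\<^sup>2 - 1"
  shows "arctan (1 / Lucas r) = bbp 1 (golden ^ (4 * N)) (4 * N) (arctan_coeff r)
    \<and> bbp 1 (golden ^ (4 * N)) (4 * N) (arctan_coeff r)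
        = (\<Sum>k. 1 / golden ^ (4 * N * k) * (\<Sum>i=1..4 * N. arctan_coeff r i / real (4 * N * k + i)))
    \<and> summable (\<lambda>k. 1 / golden ^ (4 * N * k) *
        (\<Sum>i=1..4 * N. arctan_coeff r i / real (4 * N * k + i)))"
proof -
  define c where "c i = real (r + 1) * dilated_chi4 (r + 1) i - real (r - 1) * dilated_chi4 (r - 1) i" for i
  define f where "f n = c n * golden_conj ^ n / real n" for n
  let ?S = "\<lambda>k. 1 / golden ^ (4 * N * k) * (\<Sum>i=1..4 * N. arctan_coeff r i / real (4 * N * k + i))"
  have "r \<ge> 2" using assms(1,2) by presburger
  have N: "N = (r - 1) * (r + 1)"
    using \<open>r \<ge> 2\<close> unfolding assms(3) power2_eq_square by (cases r) auto
  then have "N > 0" using \<open>r \<ge> 2\<close> by simp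
  have per: "c (4 * N * k + i) = c i" for k i
    unfolding c_def
    using dilated_chi4_add_period[of "r + 1" N k i] dilated_chi4_add_period[of "r - 1" N k i]
      N \<open>r \<ge> 2\<close> by (simp only: dvd_triv_left dvd_triv_right)
  have "f sums arctan (1 / Lucas r)"
    unfolding f_def[abs_def] c_def left_diff_distrib diff_divide_distrib
      arctan_inverse_Lucas[OF assms(1,2)]
    using abs_golden_conj \<open>r \<ge> 2\<close> by (intro sums_diff dilated_chi4_series_arctan) simp_all
  then have "(\<lambda>k. \<Sum>i=1..4 * N. f (4 * N * k + i)) sums arctan (1 / Lucas r)"
    \<comment> \<open>Here \<open>f 0 = 0\<close> because division by zero yields 0.\<close>
    by (rule sums_blocks_from_1) (use \<open>N > 0\<close> in \<open>simp_all add: f_def\<close>)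
  moreover have "(\<Sum>i=1..4 * N. f (4 * N * k + i)) = ?S k" for k
  proof -
    \<comment> \<open>Periodicity reduces the coefficient to \<open>c i\<close>. The power of
      \<beta> splits into \<beta>^(4Nk), which is \<alpha>^(-4Nk) as the exponent is even, and
      \<beta>^i, which \<open>arctan_coeff r i\<close> absorbs.\<close>
    have "f (4 * N * k + i) = 1 / golden ^ (4 * N * k) * (arctan_coeff r i / real (4 * N * k + i))"
      if "i \<in> {1..4 * N}" for i
      using arctan_coeff_eq[OF assms(1,2), of i] that golden_conj_power_even[of "4 * N * k"]
      unfolding f_def per assms(3)[symmetric] c_def[symmetric] by (simp add: power_add)
    then show ?thesis by (simp add: sum_distrib_left)
  qed
  ultimately have S: "?S sums arctan (1 / Lucas r)" by simp
  moreover have "bbp 1 (golden ^ (4 * N)) (4 * N) (arctan_coeff r) = suminf ?S"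
    unfolding bbp_def by (simp add: power_mult[symmetric] mult.commute mult.left_commute)
  ultimately show ?thesis by (simp only: sums_iff)
qed

end
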